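(* Let $\mathcal F=\text{C-RASP}^2$ with complexity measure $\mathcal C(f)=T(f)^{K(f)}$. If the ground-truth function $f_*$ has $T(f_* )\le T$ and $K(f_* )\le K$, then the Minimum-Complexity Interpolator with complexity $\mathcal C$ and function class $\mathcal F$ length generalizes given inputs of length $O(T^{O(K)})$. That is, there is an absolute constant $C_0>0$ such that for all integers $T,K\ge1$, for every $f_*$ computed by a $\text{C-RASP}^2$ program with at most $K$ heads and parameter bound at most $T$, and for all $N\ge C_0T^{C_0K}$, the program output by the Minimum-Complexity Interpolator on $D_N(f_* )$ computes $f_*$ on all of $\{0,1\}^*$.
   Context: For a $\{0,1\}$-sequence $h$ write $\mathrm{ps}(h)_j=\sum_{l=1}^j h_l$. $\text{C-RASP}^{2,K,T}$ (integers $T\ge1$, $1\le K\le T^2$): the set of programs given by an integer $z$ with $0<z\le T$ and integers $a^{(i)},b^{(i)},\lambda_i\in\{-T,\dots,T\}$ for $i\in[K]$, with $a^{(i)}>0$, $b^{(i)}/a^{(i)}\in(0,1)$ and pairwise distinct for $i\in[K]$, and $\sum_{i\in[K]}\lambda_i>z$. On $x\in\{0,1\}^n$ the first layer computes $K$ heads $$h^{(i)}_j=\mathbf 1\big[\mathrm{ps}(x)_j>\tfrac{b^{(i)}}{a^{(i)}}j\big],\qquad j\in[n],\ i\in[K],$$ and the output is $f(x)=\mathbf 1\big[\sum_{i\in[K]}\lambda_i\,\mathrm{ps}(h^{(i)})_n>z\cdot n\big]$ (for $n=0$ this is $0$). $\text{C-RASP}^2=\bigcup_{1\le T,\,1\le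 K\le T^2}\text{C-RASP}^{2,K,T}$. For a program $f$, $K(f)$ is its number of heads and $T(f)=\max(\max_i|a^{(i)}|,\max_i|b^{(i)}|,\max_i|\lambda_i|,|z|)$; its complexity is $\mathcal C(f)=T(f)^{K(f)}$. The complexity of a function is the minimum complexity of a program computing it. Programs are encoded by binary strings listing their parameters; invalid encodings are mapped to a default program. Training data: $D_N(f)=\{(x,f(x)):x\in\{0,1\}^*,|x|\le N\}$. The Minimum-Complexity Interpolator, given $D_N(f)$, outputs a program of minimum complexity in the class among all programs agreeing with all labels in $D_N(f)$ (ties broken by any fixed rule). *)

theory Defs imports Complex_Main begin

text \<open>Words over \<open>{0,1}\<close> are Boolean lists. Positions are numbered from 1 as in the
  mathematics, hence the shift in the list access; \<open>ps h j\<close> is only meant for \<open>j \<le> length h\<close>.\<close>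

definition ps :: "bool list \<Rightarrow> nat \<Rightarrow> int" where
  "ps h j = (\<Sum>l = 1..j. of_bool (h ! (l - 1)))"

record head =
  ha :: int
  hb :: int
  hlam :: int

record program =
  heads :: "head list"
  zthr :: int

definition slope :: "head \<Rightarrow> real" where
  "slope h = real_of_int (hb h) / real_of_int (ha h)"

definition crasp2_KT :: "nat \<Rightarrow> nat \<Rightarrow> program set" where
  "crasp2_KT K T = {p. length (heads p) = K
     \<and> 0 < zthr p \<and> zthr p \<le> int T
     \<and> (\<forall>h\<in>set (heads p).
          ha h \<in> {- int T..int T} \<and> hb h \<in> {- int T..int T} \<and> hlam h \<in> {- int T..int T}
          \<and> ha h > 0 \<and> slope h \<in> {0<..<1})
     \<and> distinct (map slope (heads p))
     \<and> (\<Sum>h\<leftarrow>heads p. hlam h) > zthr p}"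

definition crasp2 :: "program set" where
  "crasp2 = (\<Union>T\<in>{1..}. \<Union>K\<in>{1..T^2}. crasp2_KT K T)"

definition head_out :: "head \<Rightarrow> bool list \<Rightarrow> bool list" where
  "head_out h x = map (\<lambda>j. real_of_int (ps x j) > slope h * real j) [1..<Suc (length x)]"

definition run :: "program \<Rightarrow> bool list \<Rightarrow> bool" where
  "run p x \<longleftrightarrow>
     (\<Sum>h\<leftarrow>heads p. hlam h * ps (head_out h x) (length x)) > zthr p * int (length x)"

definition num_heads :: "program \<Rightarrow> nat" where
  "num_heads p = length (heads p)"

definition param_bound :: "program \<Rightarrow> nat" where
  "param_bound p = Max ({nat \<bar>zthr p\<bar>} \<union>
     (\<Union>h\<in>set (heads p). {nat \<bar>ha h\<bar>, nat \<bar>hb h\<bar>, nat \<bar>hlam h\<bar>}))"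

definition crasp2_complexity :: "program \<Rightarrow> nat" where
  "crasp2_complexity p = param_bound p ^ num_heads p"

definition training_data :: "nat \<Rightarrow> (bool list \<Rightarrow> bool) \<Rightarrow> (bool list \<times> bool) set" where
  "training_data N f = {(x, f x) | x. length x \<le> N}"

text \<open>\<open>A\<close> is a Minimum-Complexity Interpolator for the program class \<open>P\<close> with semantics \<open>sem\<close>
  and complexity \<open>C\<close>. Ties are broken in a fixed but arbitrary way, since \<open>A\<close> is an arbitrary
  function of the data set; it is only constrained on data labelled by a function that some
  program in the class computes.\<close>

definition min_complexity_interpolator ::
  "'p set \<Rightarrow> ('p \<Rightarrow> bool list \<Rightarrow> bool) \<Rightarrow> ('p \<Rightarrow> nat) \<Rightarrow>
   ((bool list \<times> bool) set \<Rightarrow> 'p) \<Rightarrow> bool" where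
  "min_complexity_interpolator P sem C A \<longleftrightarrow>
     (\<forall>N. \<forall>f\<in>sem ` P.
        is_arg_min C (\<lambda>p. p \<in> P \<and> (\<forall>(x, y)\<in>training_data N f. sem p x = y))
          (A (training_data N f)))"

end

theory Submission imports Defs begin

text \<open>
  Let \<open>D\<close> be a common denominator of all slopes of two programs. Each program then assigns an
  integer weight to each of the \<open>D\<close> cones \<open>k/D < c/j \<le> (k+1)/D\<close> in the plane of positions \<open>j\<close> and
  counts \<open>c\<close>, and it accepts a word iff the weights of the cones visited by its counting path have
  a positive sum. Beyond position \<open>D\<close> a path can move to a neighbouring cone or stay in its cone
  forever, and crossing all cones multiplies its length by at most \<open>D + 1\<close>.

  If the programs agree on all words of length polynomial in \<open>D\<close> and the largest weight, then their
  weights \<open>u\<close>, \<open>v\<close> are proportional. Indeed, for some cones \<open>r < s\<close> with \<open>u\<close>, \<open>v\<close> vanishing in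
  between, the vectors \<open>(u, v)\<close> at \<open>r\<close> and \<open>s\<close> point to the negative and to the positive quadrant.
  Take a combination \<open>a u - b v\<close> with \<open>a, b \<ge> 0\<close> that vanishes at \<open>r\<close>. If it is positive at a cone
  \<open>i\<close> and nonnegative between \<open>i\<close>, \<open>r\<close> and \<open>s\<close>, then a long stay in \<open>i\<close> followed by stays in \<open>s\<close>
  and \<open>r\<close> makes one program change its answer while the other one cannot.

  A program of complexity at most \<open>M = T^K\<close> has denominator, weights and number of heads polynomial
  in \<open>M\<close>, and the interpolator never outputs a program more complex than the ground truth.
\<close>

section \<open>Cones and traces of words\<close>

text \<open>Truncated subtraction puts words without \<open>True\<close> into cone 0.\<close>

definition cone :: "nat \<Rightarrow> bool list \<Rightarrow> nat" where
  "cone D x = (count_list x True * D - 1) div length x"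

definition trace :: "nat \<Rightarrow> bool list \<Rightarrow> nat list" where
  "trace D x = map (\<lambda>j. cone D (take (Suc j) x)) [0..<length x]"

definition score :: "nat \<Rightarrow> (nat \<Rightarrow> int) \<Rightarrow> bool list \<Rightarrow> int" where
  "score D w x = (\<Sum>k\<leftarrow>trace D x. w k)"

lemma length_trace [simp]: "length (trace D x) = length x"
  by (simp add: trace_def)

lemma trace_snoc: "trace D (x @ [b]) = trace D x @ [cone D (x @ [b])]"
  by (simp add: trace_def)

lemma trace_append:
  "trace D (x @ y) = trace D x @ map (\<lambda>j. cone D (x @ take (Suc j) y)) [0..<length y]"
proof (induction y rule: rev_induct)
  case (snoc b y)
  have "trace D (x @ y @ [b]) = trace D (x @ y) @ [cone D (x @ y @ [b])]"
    using trace_snoc[of D "x @ y" b] by simp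
  then show ?case using snoc by simp
qed simp

lemma score_append:
  "trace D (x @ y) = trace D x @ ks \<Longrightarrow> score D w (x @ y) = score D w x + (\<Sum>k\<leftarrow>ks. w k)"
  by (simp add: score_def)

lemma cone_bounds:
  assumes "x \<noteq> []"
  shows "cone D x * length x \<le> count_list x True * D - 1"
    and "count_list x True * D - 1 < Suc (cone D x) * length x"
  using assms dividend_less_div_times[of "length x" "count_list x True * D - 1"]
  by (auto simp: cone_def)

lemma cone_less:
  assumes "D \<ge> 1" "x \<noteq> []"
  shows "cone D x < D"
proof -
  have "count_list x True * D \<le> length x * D"
    using count_le_length[of x True] by simp
  moreover have "0 < length x * D" using assms by simp
  ultimately have "count_list x True * D - 1 < D * length x"
    unfolding mult.commute[of D] by linarith
  then show ?thesis unfolding cone_def by (rule less_mult_imp_div_less)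
qed

section \<open>Steering a counting path through the cones\<close>

lemma cone_eqI_bounds:
  assumes "x \<noteq> []"
  shows "k * length x \<le> count_list x True * D - 1 \<Longrightarrow> k \<le> cone D x"
    and "count_list x True * D - 1 < k * length x \<Longrightarrow> cone D x < k"
  using assms by (simp_all add: cone_def less_eq_div_iff_mult_less_eq less_mult_imp_div_less)

text \<open>A letter changes the numerator \<open>c * D\<close> by at most \<open>D\<close> and the
  length by 1; as \<open>D \<le> length x\<close>, the quotient moves by at most one. If appending
  \<open>False\<close> leaves cone \<open>k\<close>, the path lies so close to the lower boundary of
  \<open>k\<close> that appending \<open>True\<close> cannot reach cone \<open>k + 1\<close>. Hence
  one of the two letters always stays.\<close>

lemma cone_step:
  assumes "D \<ge> 1" "D \<le> length x"
  shows "cone D x \<le> cone D (x @ [True])" "cone D (x @ [True]) \<le> Suc (cone D x)"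
    and "cone D (x @ [False]) \<le> cone D x" "cone D x \<le> Suc (cone D (x @ [False]))"
    and "\<exists>b. cone D (x @ [b]) = cone D x"
proof -
  let ?n = "length x" and ?c = "count_list x True"
  define k where "k = cone D x"
  have ne: "x \<noteq> []" using assms by auto
  have k1: "k * ?n \<le> ?c * D - 1" and k2: "?c * D - 1 < Suc k * ?n"
    unfolding k_def using cone_bounds[OF ne] by auto
  have kD: "k < D" unfolding k_def using cone_less[OF assms(1) ne] .
  show up: "cone D x \<le> cone D (x @ [True])"
    using k1 kD assms(1) unfolding k_def[symmetric] by (intro cone_eqI_bounds) auto
  have "cone D (x @ [True]) < Suc (Suc k)"
    using k2 assms by (intro cone_eqI_bounds) auto
  then show "cone D (x @ [True]) \<le> Suc (cone D x)" by (simp add: k_def)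
  have "cone D (x @ [False]) < Suc k"
    using k2 assms by (intro cone_eqI_bounds) auto
  then show down: "cone D (x @ [False]) \<le> cone D x" by (simp add: k_def)
  have "k - 1 \<le> cone D (x @ [False])"
    using k1 kD assms(2) by (intro cone_eqI_bounds) (auto simp: algebra_simps diff_mult_distrib)
  then show "cone D x \<le> Suc (cone D (x @ [False]))" by (simp add: k_def)
  show "\<exists>b. cone D (x @ [b]) = cone D x"
  proof (cases "cone D (x @ [False]) = cone D x")
    case False
    then have "\<not> k * Suc ?n \<le> ?c * D - 1"
      using cone_eqI_bounds(1)[of "x @ [False]" k D] down by (auto simp: k_def)
    then have "Suc ?c * D - 1 < Suc k * Suc ?n"
      using assms by auto
    then have "cone D (x @ [True]) < Suc k" by (intro cone_eqI_bounds) auto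
    then show ?thesis using up by (intro exI[of _ True]) (auto simp: k_def)
  qed blast
qed

lemma stay:
  assumes "D \<ge> 1" "D \<le> length x"
  shows "\<exists>y. trace D (x @ y) = trace D x @ replicate m (cone D x) \<and> cone D (x @ y) = cone D x"
proof (induction m)
  case 0
  show ?case by (intro exI[of _ "[]"]) simp
next
  case (Suc m)
  then obtain y where y: "trace D (x @ y) = trace D x @ replicate m (cone D x)"
    "cone D (x @ y) = cone D x" by blast
  obtain b where b: "cone D ((x @ y) @ [b]) = cone D (x @ y)"
    using cone_step(5)[OF assms(1), of "x @ y"] assms(2) by auto
  show ?case
    using y b trace_snoc[of D "x @ y" b]
    by (intro exI[of _ "y @ [b]"]) (simp add: replicate_append_same)
qed

text \<open>Discrete intermediate value theorem: at the first time with value at least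
  \<open>k\<close>, a path with steps of size at most 1 cannot have overshot.\<close>

lemma nat_path_hits_up:
  fixes f :: "nat \<Rightarrow> nat"
  assumes "\<And>n. f n \<le> f (Suc n)" "\<And>n. f (Suc n) \<le> Suc (f n)" "f 0 \<le> k" "k \<le> f n"
  shows "\<exists>m\<le>n. f m = k \<and> (\<forall>j\<le>m. f j \<in> {f 0..k})"
proof -
  have mono: "f i \<le> f j" if "i \<le> j" for i j
    using lift_Suc_mono_le[of f, OF assms(1) that] .
  define m where "m = (LEAST m. k \<le> f m)"
  have m: "k \<le> f m" "m \<le> n" unfolding m_def using assms(4) by (auto intro: LeastI Least_le)
  have "f m \<le> k"
  proof (cases m)
    case (Suc j)
    then have "f j < k" using not_less_Least[of j "\<lambda>m. k \<le> f m"] by (simp add: m_def)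
    then show ?thesis using assms(2)[of j] Suc by simp
  qed (use assms(3) in simp)
  with m mono show ?thesis by (intro exI[of _ m]) force
qed

text \<open>The reflected path \<open>f 0 - f n\<close> ascends, which reduces the claim to the
  previous case.\<close>

lemma nat_path_hits_down:
  fixes f :: "nat \<Rightarrow> nat"
  assumes "\<And>n. f (Suc n) \<le> f n" "\<And>n. f n \<le> Suc (f (Suc n))" "k \<le> f 0" "f n \<le> k"
  shows "\<exists>m\<le>n. f m = k \<and> (\<forall>j\<le>m. f j \<in> {k..f 0})"
proof -
  have le: "f n \<le> f 0" for n
    using lift_Suc_antimono_le[of f 0 n, OF assms(1)] by simp
  have "\<exists>m\<le>n. f 0 - f m = f 0 - k \<and> (\<forall>j\<le>m. f 0 - f j \<in> {f 0 - f 0..f 0 - k})"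
  proof (rule nat_path_hits_up)
    show "f 0 - f n \<le> f 0 - f (Suc n)" for n using assms(1)[of n] by simp
    show "f 0 - f (Suc n) \<le> Suc (f 0 - f n)" for n using assms(2)[of n] by simp
    show "f 0 - k \<le> f 0 - f n" using assms(4) by simp
  qed simp
  then obtain m where m: "m \<le> n" "f 0 - f m = f 0 - k" "\<forall>j\<le>m. f 0 - f j \<in> {f 0 - f 0..f 0 - k}"
    by blast
  have "f m = k" using m(2) le[of m] assms(3) by simp
  moreover have "f j \<in> {k..f 0}" if "j \<le> m" for j
    using m(3) that le[of j] assms(3) by fastforce
  ultimately show ?thesis using m(1) by blast
qed

text \<open>Repeating one letter moves the path monotonically. With \<open>D * length x\<close>
  copies of \<open>True\<close> the fraction of \<open>True\<close> is at least D/(D+1), which lies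
  in the top cone; with as many copies of \<open>False\<close> it is at most 1/(D+1), which lies in
  cone 0. On the way every intermediate cone is hit.\<close>

lemma reach:
  assumes "D \<ge> 1" "D \<le> length x" "i < D"
  shows "\<exists>y ks. trace D (x @ y) = trace D x @ ks \<and> cone D (x @ y) = i
    \<and> set ks \<subseteq> {min (cone D x) i..max (cone D x) i} \<and> length ks \<le> D * length x"
proof -
  let ?n = "length x" and ?c = "count_list x True"
  have ne: "x \<noteq> []" using assms by auto
  have cnt: "?c \<le> ?n" by (rule count_le_length)
  have count_rep: "count_list (replicate m b) True = (if b then m else 0)" for m b
    by (induction m) auto
  define f where "f b m = cone D (x @ replicate m b)" for b m
  have f_Suc: "f b (Suc m) = cone D ((x @ replicate m b) @ [b])" for b m
    by (simp add: f_def replicate_append_same)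
  have step: "f True m \<le> f True (Suc m)" "f True (Suc m) \<le> Suc (f True m)"
    "f False (Suc m) \<le> f False m" "f False m \<le> Suc (f False (Suc m))" for m
    using cone_step[of D "x @ replicate m True"] cone_step[of D "x @ replicate m False"] assms
    by (auto simp: f_Suc) (auto simp: f_def)
  have "\<exists>b. \<exists>m\<le>D * ?n. f b m = i \<and> (\<forall>j\<le>m. f b j \<in> {min (cone D x) i..max (cone D x) i})"
  proof (cases "cone D x \<le> i")
    case True
    have "i * (?n + D * ?n) \<le> (D - 1) * (?n + D * ?n)" using assms(3) by (intro mult_right_mono) auto
    also have "\<dots> \<le> (?c + D * ?n) * D - 1"
    proof -
      have "(D - 1) * (?n + D * ?n) + ?n = D * ?n * D"
        using assms(1) by (cases D) (auto simp: algebra_simps)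
      moreover have "?n \<ge> 1" using ne by (cases x) auto
      ultimately show ?thesis by (simp add: algebra_simps)
    qed
    finally have "i \<le> f True (D * ?n)"
      unfolding f_def using ne by (intro cone_eqI_bounds) (auto simp: count_rep)
    with True have "\<exists>m\<le>D * ?n. f True m = i \<and> (\<forall>j\<le>m. f True j \<in> {f True 0..i})"
      by (intro nat_path_hits_up step) (auto simp: f_def)
    then show ?thesis using True by (intro exI[of _ True]) (auto simp: f_def)
  next
    case False
    have "?c * D - 1 < 1 * (?n + D * ?n)"
    proof -
      have "?c * D \<le> ?n * D" using cnt by simp
      moreover have "?n \<ge> 1" using ne by (cases x) auto
      ultimately show ?thesis unfolding mult.commute[of D] mult_1 by linarith
    qed
    then have "f False (D * ?n) < 1"
      unfolding f_def using ne by (intro cone_eqI_bounds) (auto simp: count_rep)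
    with False have "\<exists>m\<le>D * ?n. f False m = i \<and> (\<forall>j\<le>m. f False j \<in> {i..f False 0})"
      by (intro nat_path_hits_down step) (auto simp: f_def)
    then show ?thesis using False by (intro exI[of _ False]) (auto simp: f_def)
  qed
  then obtain b m where m: "m \<le> D * ?n" "f b m = i"
    "\<forall>j\<le>m. f b j \<in> {min (cone D x) i..max (cone D x) i}" by blast
  let ?ks = "map (\<lambda>j. f b (Suc j)) [0..<m]"
  have "trace D (x @ replicate m b) = trace D x @ ?ks"
    by (auto simp: trace_append f_def min_def)
  moreover have "set ?ks \<subseteq> {min (cone D x) i..max (cone D x) i}" using m(3) by auto
  ultimately show ?thesis
    using m by (intro exI[of _ "replicate m b"] exI[of _ ?ks]) (auto simp: f_def)
qed

lemma visit:
  assumes "D \<ge> 1" "D \<le> length x" "i < D"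
  obtains y ks where "trace D (x @ y) = trace D x @ ks @ replicate m i" "cone D (x @ y) = i"
    "set ks \<subseteq> {min (cone D x) i..max (cone D x) i}" "length ks \<le> D * length x"
    "length y = length ks + m"
proof -
  obtain y ks where y: "trace D (x @ y) = trace D x @ ks" "cone D (x @ y) = i"
    "set ks \<subseteq> {min (cone D x) i..max (cone D x) i}" "length ks \<le> D * length x"
    using reach[OF assms] by blast
  obtain z where z: "trace D ((x @ y) @ z) = trace D (x @ y) @ replicate m i"
    "cone D ((x @ y) @ z) = i"
    using stay[of D "x @ y" m] assms y(2) by auto
  have "trace D (x @ (y @ z)) = trace D x @ ks @ replicate m i" using y z by simp
  moreover from this have "length (trace D (x @ (y @ z))) = length x + length ks + m" by simp
  then have "length (y @ z) = length ks + m" by simp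
  ultimately show ?thesis using that[of "y @ z" ks] y z by simp
qed

section \<open>Score estimates and long stays\<close>

lemma abs_sum_list_le:
  fixes w :: "'a \<Rightarrow> int"
  assumes "\<And>k. \<bar>w k\<bar> \<le> B"
  shows "\<bar>\<Sum>k\<leftarrow>ks. w k\<bar> \<le> B * int (length ks)"
proof (induction ks)
  case (Cons k ks)
  then show ?case using assms[of k] by (simp add: algebra_simps)
qed simp

lemma abs_score_le:
  assumes "\<And>k. \<bar>w k\<bar> \<le> B"
  shows "\<bar>score D w x\<bar> \<le> B * int (length x)"
  using abs_sum_list_le[of w B "trace D x", OF assms] by (simp add: score_def)

lemma sum_list_linear:
  fixes u v :: "'a \<Rightarrow> int"
  shows "(\<Sum>k\<leftarrow>ks. a * u k - b * v k) = a * (\<Sum>k\<leftarrow>ks. u k) - b * (\<Sum>k\<leftarrow>ks. v k)"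
  by (simp add: sum_list_subtractf sum_list_const_mult)

lemma score_uminus: "score D (\<lambda>k. - w k) x = - score D w x"
  by (simp add: score_def uminus_sum_list_map o_def)

text \<open>The basic move of the arguments below: a stay in a cone of positive weight enforces a
  large score, at the price of a constant factor in the length. It is applied to \<open>- w\<close>
  for cones of negative weight.\<close>

lemma visit_long:
  fixes C E :: int
  assumes "D \<ge> 1" "D \<le> length x" "i < D" "C \<ge> 0" "E \<ge> 0"
    and w: "\<And>k. \<bar>w k\<bar> \<le> C" "w i > 0"
  obtains y ks where "trace D (x @ y) = trace D x @ ks" "cone D (x @ y) = i"
    "set ks \<subseteq> {min (cone D x) i..max (cone D x) i}"
    "int (length (x @ y)) \<le> (1 + C) * (1 + int D) * int (length x) + E + 1"
    "score D w (x @ y) > E"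
proof -
  \<comment> \<open>The first summand bounds the loss on \<open>x\<close> and on the at most
    \<open>D * length x\<close> letters of the transit. Each letter of the stay gains at least 1
    because \<open>w i\<close> is a positive integer.\<close>
  define m where "m = nat (C * (1 + int D) * int (length x) + E + 1)"
  have m: "int m = C * (1 + int D) * int (length x) + E + 1"
    using assms(4,5) by (simp add: m_def)
  obtain y ks where y: "trace D (x @ y) = trace D x @ ks @ replicate m i" "cone D (x @ y) = i"
    "set ks \<subseteq> {min (cone D x) i..max (cone D x) i}" "length ks \<le> D * length x"
    "length y = length ks + m"
    using visit[OF assms(1-3)] by blast
  have len: "int (length ks) \<le> int D * int (length x)"
    using y(4) by (metis of_nat_le_iff of_nat_mult)
  have "\<bar>score D w x\<bar> \<le> C * int (length x)" "\<bar>\<Sum>k\<leftarrow>ks. w k\<bar> \<le> C * int (length ks)"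
    using abs_score_le abs_sum_list_le w(1) by blast+
  moreover have "C * int (length ks) \<le> C * (int D * int (length x))"
    using len assms(4) by (rule mult_left_mono)
  moreover have "int m * w i \<ge> int m" using w(2) by (simp add: mult_le_cancel_left1)
  moreover have "score D w (x @ y) = score D w x + (\<Sum>k\<leftarrow>ks. w k) + int m * w i"
    using score_append[OF y(1), of w] by (simp add: sum_list_replicate)
  ultimately have pos: "score D w (x @ y) > E" using m by (simp add: algebra_simps)
  show ?thesis
  proof (rule that[OF y(1,2) _ _ pos])
    show "set (ks @ replicate m i) \<subseteq> {min (cone D x) i..max (cone D x) i}" using y(3) by auto
    show "int (length (x @ y)) \<le> (1 + C) * (1 + int D) * int (length x) + E + 1"
      using len m y(5) by (simp add: algebra_simps)
  qed
qed

section \<open>Two weightings that agree on short words\<close>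

text \<open>Length bookkeeping: a basic move costs a factor \<open>Q\<close>, and the additive 1 is
  absorbed into the coefficient.\<close>

lemma power_growth:
  fixes Q :: int
  assumes "n \<le> c * Q ^ e" "m \<le> Q * n + 1" "Q \<ge> 1"
  shows "m \<le> (c + 1) * Q ^ Suc e"
proof -
  have "Q * n \<le> Q * (c * Q ^ e)" using assms by (intro mult_left_mono) auto
  moreover have "1 \<le> Q ^ Suc e" using assms by (intro one_le_power)
  moreover have "(c + 1) * Q ^ Suc e = Q * (c * Q ^ e) + Q ^ Suc e" by (simp add: algebra_simps)
  ultimately show ?thesis using assms(2) by linarith
qed

text \<open>Two programs are reduced to weightings of the same \<open>D\<close> cones. The signs at
  the ends provide a sign change to work with, and the sixth power leaves room for three consecutive
  basic moves.\<close>

locale agreement =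
  fixes D N :: nat and B :: int and u v :: "nat \<Rightarrow> int"
  assumes D: "D \<ge> 1"
    and u_le: "\<bar>u k\<bar> \<le> B" and v_le: "\<bar>v k\<bar> \<le> B"
    and ends: "u 0 < 0" "v 0 < 0" "u (D - 1) > 0" "v (D - 1) > 0"
    and N: "((1 + B) * (1 + int D)) ^ 6 \<le> int N"
    and agree: "length x \<le> N \<Longrightarrow> score D u x > 0 \<longleftrightarrow> score D v x > 0"
begin

lemma swap: "agreement D N B v u"
  using D u_le v_le ends N agree by unfold_locales auto

text \<open>While \<open>a * S\<^sub>u - b * S\<^sub>v > b * B\<close> holds, \<open>S\<^sub>v\<close> cannot enter \<open>{-B<..0}\<close>,
  since there \<open>S\<^sub>u\<close> would be positive; steps of size at most \<open>B\<close> cannot jump over this interval.\<close>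

lemma positivity_persists:
  assumes "a > 0" "b \<ge> 0"
    and "a * score D u x - b * score D v x > b * B" "score D v x > 0"
    and "trace D (x @ y) = trace D x @ ks" "\<forall>k\<in>set ks. a * u k - b * v k \<ge> 0"
    and "length (x @ y) \<le> N"
  shows "score D v (x @ y) > 0"
proof -
  have "score D v (x @ y) > 0 \<and> a * score D u (x @ y) - b * score D v (x @ y) > b * B"
    using assms(5-7)
  proof (induction y arbitrary: ks rule: rev_induct)
    case Nil
    then show ?case using assms by simp
  next
    case (snoc c y)
    define k where "k = cone D (x @ y @ [c])"
    have tr: "trace D ((x @ y) @ [c]) = trace D (x @ y) @ [k]"
      using trace_snoc[of D "x @ y" c] by (simp add: k_def)
    obtain ks' where ks': "trace D (x @ y) = trace D x @ ks'"
      using trace_append by blast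
    then have ks: "ks = ks' @ [k]" using tr snoc.prems(1) by simp
    have IH: "score D v (x @ y) > 0" "a * score D u (x @ y) - b * score D v (x @ y) > b * B"
      using snoc.IH[OF ks'] snoc.prems ks by auto
    have su: "score D u (x @ y @ [c]) = score D u (x @ y) + u k"
      and sv: "score D v (x @ y @ [c]) = score D v (x @ y) + v k"
      using score_append[OF tr] by auto
    have "a * u k - b * v k \<ge> 0" using snoc.prems(2) ks by simp
    with IH(2) have phi: "a * score D u (x @ y @ [c]) - b * score D v (x @ y @ [c]) > b * B"
      unfolding su sv by (simp add: algebra_simps)
    have "score D v (x @ y @ [c]) > 0"
    proof (rule ccontr)
      assume *: "\<not> ?thesis"
      have "score D v (x @ y @ [c]) \<ge> - B" using sv IH(1) v_le[of k] by linarith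
      then have "b * score D v (x @ y @ [c]) \<ge> - (b * B)"
        using mult_left_mono[OF _ assms(2), of "- B"] by simp
      then have "a * score D u (x @ y @ [c]) > 0" using phi by linarith
      then have "score D u (x @ y @ [c]) > 0" using assms(1) by (simp add: zero_less_mult_iff)
      then show False using agree[of "x @ y @ [c]"] snoc.prems(3) * by simp
    qed
    then show ?case using phi by blast
  qed
  then show ?thesis by blast
qed

lemma B: "B \<ge> 1"
  using u_le[of 0] ends by simp

text \<open>A long stay in \<open>i\<close> lifts the score of \<open>w = a * u - b * v\<close>
  above \<open>b * B\<close>. A stay in \<open>s\<close> then makes the score of \<open>u\<close>,
  and by agreement that of \<open>v\<close>, positive without lowering the score of
  \<open>w\<close>. A final stay in \<open>r\<close> drives the score of \<open>v\<close> below 0,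
  against \<open>positivity_persists\<close>.\<close>

lemma positive_exit:
  assumes ab: "a > 0" "b \<ge> 0" "a \<le> B" "b \<le> B"
    and idx: "i \<in> {lo..hi}" "r \<in> {lo..hi}" "s \<in> {lo..hi}" "hi < D"
    and nonneg: "\<forall>k\<in>{lo..hi}. a * u k - b * v k \<ge> 0"
    and pos: "a * u i - b * v i > 0" and s: "u s > 0" and r: "v r < 0"
  shows False
proof -
  define w where "w k = a * u k - b * v k" for k
  define Q where "Q = (1 + B) * (1 + int D)"
  have score_w: "score D w x = a * score D u x - b * score D v x" for x
    unfolding score_def w_def by (rule sum_list_linear)
  have BB: "1 \<le> B * B" using mult_mono[of 1 B 1 B] B by simp
  have w_le: "\<bar>w k\<bar> \<le> 2 * (B * B)" for k
  proof -
    have "\<bar>a * u k\<bar> \<le> B * B" "\<bar>b * v k\<bar> \<le> B * B"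
      using ab B u_le[of k] v_le[of k] by (auto simp: abs_mult intro!: mult_mono)
    then show ?thesis by (simp add: w_def)
  qed
  have hull: "sum_list (map w ks) \<ge> 0" if "set ks \<subseteq> {lo..hi}" for ks
    using that nonneg by (intro sum_list_nonneg) (auto simp: w_def)
  have Q: "Q \<ge> 4"
    using mult_mono[of 2 "1 + B" 2 "1 + int D"] B D by (simp add: Q_def)
  \<comment> \<open>A word of length \<open>D\<close>, the least length from which
    \<open>visit_long\<close> can start.\<close>
  define x where "x = replicate D False"
  \<comment> \<open>The way from \<open>x\<close> to \<open>i\<close> may leave
    \<open>{lo..hi}\<close>: the stay compensates for all earlier losses. Only the later moves have
    to remain inside.\<close>
  obtain y1 ks1 where 1: "cone D (x @ y1) = i" "score D w (x @ y1) > B * B"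
    "int (length (x @ y1)) \<le> (1 + 2 * (B * B)) * (1 + int D) * int D + B * B + 1"
    using visit_long[of D x i "2 * (B * B)" "B * B" w] D idx BB w_le pos[folded w_def]
    by (auto simp: x_def)
  define x1 where "x1 = x @ y1"
  have len1: "D \<le> length x1" by (simp add: x1_def x_def)
  have sD: "s < D" and rD: "r < D" and B0: "0 \<le> B" using idx B by auto
  have c1: "cone D x1 = i" using 1(1) by (simp add: x1_def)
  obtain y2 ks2 where 2: "trace D (x1 @ y2) = trace D x1 @ ks2" "cone D (x1 @ y2) = s"
    "set ks2 \<subseteq> {min i s..max i s}" "score D u (x1 @ y2) > 0"
    "int (length (x1 @ y2)) \<le> Q * int (length x1) + 1"
    by (rule visit_long[where w = u and E = 0, OF D len1 sD B0 order_refl u_le s, unfolded c1])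
      (rule that, auto simp: Q_def)
  define x2 where "x2 = x1 @ y2"
  have len2: "D \<le> length x2" using len1 by (simp add: x2_def)
  have c2: "cone D x2 = s" using 2(2) by (simp add: x2_def)
  have mv_le: "\<bar>- v k\<bar> \<le> B" for k using v_le by simp
  have mr: "0 < - v r" using r by simp
  obtain y3 ks3 where 3: "trace D (x2 @ y3) = trace D x2 @ ks3"
    "set ks3 \<subseteq> {min s r..max s r}" "score D v (x2 @ y3) < 0"
    "int (length (x2 @ y3)) \<le> Q * int (length x2) + 1"
    by (rule visit_long[where w = "\<lambda>k. - v k" and E = 0, OF D len2 rD B0 order_refl mv_le mr, unfolded c2])
      (rule that, auto simp: Q_def score_uminus)
  have len: "length (x2 @ y3) \<le> N"
  proof -
    \<comment> \<open>The first move uses the weight bound \<open>2 * (B * B)\<close> instead of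
      \<open>B\<close>, so its length is compared with \<open>2 * Q ^ 2\<close> by expansion. Each
      of the other two moves raises coefficient and exponent by one.\<close>
    have "int (length x1) \<le> 2 * Q ^ 2"
    proof -
      define d where "d = int D"
      have "0 \<le> B" "0 \<le> B * B" "0 \<le> B * d" "0 \<le> B * (d * d)" "0 \<le> B * (B * d)"
        "0 \<le> d * d" "0 \<le> d" using B by (auto simp: d_def)
      moreover have "(1 + 2 * (B * B)) * (1 + d) * d + B * B + 1
          = 1 + B * B + d + d * d + 2 * (B * (B * d)) + 2 * (B * (B * (d * d)))"
        by (simp add: algebra_simps)
      moreover have "2 * Q ^ 2 = 2 + 4 * B + 2 * (B * B) + 4 * d + 2 * (d * d) + 8 * (B * d)
          + 4 * (B * (B * d)) + 4 * (B * (d * d)) + 2 * (B * (B * (d * d)))"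
        by (simp add: Q_def d_def power2_eq_square algebra_simps)
      ultimately show ?thesis using 1(3) unfolding x1_def[symmetric] d_def[symmetric] by linarith
    qed
    then have "int (length x2) \<le> (2 + 1) * Q ^ Suc 2"
      using 2(5) Q unfolding x2_def by (intro power_growth) auto
    then have "int (length (x2 @ y3)) \<le> (3 + 1) * Q ^ Suc 3"
      using 3(4) Q by (intro power_growth) auto
    also have "\<dots> = 4 * Q ^ 4" by simp
    also have "\<dots> \<le> Q * Q ^ 4" using Q by (intro mult_right_mono) auto
    also have "\<dots> = Q ^ 5" by (simp add: eval_nat_numeral)
    also have "\<dots> \<le> Q ^ 6" using Q by (intro power_increasing) auto
    finally show ?thesis using N by (simp add: Q_def)
  qed
  have "score D w x2 = score D w x1 + sum_list (map w ks2)"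
    using score_append[OF 2(1)] by (simp add: x2_def)
  moreover have "{min i s..max i s} \<subseteq> {lo..hi}" "{min s r..max s r} \<subseteq> {lo..hi}" using idx by auto
  ultimately have "score D w x2 > B * B" "\<forall>k\<in>set ks3. w k \<ge> 0"
    using hull[of ks2] 1(2) 2(3) 3(2) nonneg unfolding x1_def[symmetric] w_def[symmetric] by force+
  moreover have "b * B \<le> B * B" using ab B by (intro mult_right_mono) auto
  moreover have "score D v x2 > 0" using agree[of x2] 2(4) len by (simp add: x2_def)
  ultimately have "score D v (x2 @ y3) > 0"
    using positivity_persists[OF ab(1,2) _ _ 3(1)] len by (simp add: score_w w_def)
  with 3(3) show False by simp
qed

text \<open>A stay in \<open>r\<close> makes the score of \<open>u\<close> negative, so that of
  \<open>v\<close> is not positive. On the way to \<open>s\<close> and during a stay there the score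
  of \<open>v\<close> cannot rise, while that of \<open>u\<close> becomes positive.\<close>

lemma nonpos_between:
  assumes "r < D" "s < D" "u r < 0" "u s > 0" "\<forall>k\<in>{min r s..max r s}. v k \<le> 0"
  shows False
proof -
  define Q where "Q = (1 + B) * (1 + int D)"
  have Q: "Q \<ge> 4"
    using mult_mono[of 2 "1 + B" 2 "1 + int D"] B D by (simp add: Q_def)
  define x where "x = replicate D False"
  obtain y1 ks1 where 1: "cone D (x @ y1) = r" "score D u (x @ y1) < 0"
    "int (length (x @ y1)) \<le> Q * int D + 1"
    using visit_long[of D x r B 0 "\<lambda>k. - u k"] D B u_le assms(1,3)
    by (auto simp: x_def Q_def score_uminus)
  define x1 where "x1 = x @ y1"
  have len1: "D \<le> length x1" by (simp add: x1_def x_def)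
  have B0: "0 \<le> B" using B by simp
  have c1: "cone D x1 = r" using 1(1) by (simp add: x1_def)
  obtain y2 ks2 where 2: "trace D (x1 @ y2) = trace D x1 @ ks2"
    "set ks2 \<subseteq> {min r s..max r s}" "score D u (x1 @ y2) > 0"
    "int (length (x1 @ y2)) \<le> Q * int (length x1) + 1"
    by (rule visit_long[where w = u and E = 0, OF D len1 assms(2) B0 order_refl u_le assms(4), unfolded c1])
      (rule that, auto simp: Q_def)
  have len: "length (x1 @ y2) \<le> N"
  proof -
    have "int D \<le> 1 * Q ^ 1" using B by (simp add: Q_def algebra_simps)
    then have "int (length x1) \<le> (1 + 1) * Q ^ Suc 1"
      using 1(3) Q unfolding x1_def by (intro power_growth) auto
    then have "int (length x1) \<le> 2 * Q ^ 2" by (simp add: power2_eq_square)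
    then have "int (length (x1 @ y2)) \<le> (2 + 1) * Q ^ Suc 2"
      using 2(4) Q by (intro power_growth) auto
    also have "\<dots> = 3 * Q ^ 3" by simp
    also have "\<dots> \<le> Q * Q ^ 3" using Q by (intro mult_right_mono) auto
    also have "\<dots> = Q ^ 4" by (simp add: eval_nat_numeral)
    also have "\<dots> \<le> Q ^ 6" using Q by (intro power_increasing) auto
    finally show ?thesis using N by (simp add: Q_def)
  qed
  have "score D v x1 \<le> 0" using agree[of x1] 1(2) len by (simp add: x1_def)
  moreover have "sum_list (map v ks2) \<le> 0"
    using 2(2) assms(5) by (intro sum_list_nonpos) auto
  ultimately have "score D v (x1 @ y2) \<le> 0" using score_append[OF 2(1)] by simp
  then show False using agree[of "x1 @ y2"] 2(3) len by simp
qed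

text \<open>The sign of the determinant \<open>u r * v s - v r * u s\<close> decides which of
  \<open>u\<close> and \<open>v\<close> gains at \<open>s\<close> in a combination that vanishes at
  \<open>r\<close>. Either strict sign contradicts \<open>positive_exit\<close> with
  \<open>i = s\<close>, in one of the two orders of \<open>u\<close> and \<open>v\<close>.\<close>

lemma opposite_directions:
  assumes rs: "r < s" "s < D" and zero: "\<forall>k\<in>{r<..<s}. u k = 0 \<and> v k = 0"
    and r: "u r \<le> 0" "v r \<le> 0" "u r < 0 \<or> v r < 0" and s: "u s > 0"
  shows "u r < 0" "v r < 0" "v s > 0" "u r * v s = v r * u s"
proof -
  interpret sw: agreement D N B v u by (rule swap)
  have cases: "k = r \<or> k = s \<or> u k = 0 \<and> v k = 0" if "k \<in> {r..s}" for k
    using zero that by force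
  have le: "- u r \<le> B" "- v r \<le> B" using u_le[of r] v_le[of r] by auto
  \<comment> \<open>If \<open>v r = 0\<close>, the combination degenerates to a positive multiple of
    \<open>v\<close>. It serves when \<open>v s > 0\<close>; otherwise \<open>v\<close> is
    nonpositive from \<open>r\<close> to \<open>s\<close>.\<close>
  have vr: "v r < 0"
  proof (rule ccontr)
    assume "\<not> v r < 0"
    then have vr: "v r = 0" and ur: "u r < 0" using r by auto
    show False
    proof (cases "v s > 0")
      case True
      have "u r * v s < 0" using True ur by (simp add: mult_neg_pos)
      then show False
        using sw.positive_exit[of "- u r" 0 s r s r s] rs ur True le vr cases B
        by (fastforce simp: mult_le_0_iff)
    next
      case False
      then show False using nonpos_between[of r s] rs ur s vr cases by force
    qed
  qed
  have "\<not> u r * v s - v r * u s > 0"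
  proof
    assume *: "u r * v s - v r * u s > 0"
    have "\<forall>k\<in>{r..s}. - v r * u k - (- u r) * v k \<ge> 0" using cases * by force
    then show False
      using positive_exit[of "- v r" "- u r" s r s r s] rs vr r le s * by auto
  qed
  moreover have "v r * u s < 0" using vr s by (simp add: mult_neg_pos)
  ultimately have "u r * v s < 0" by linarith
  then show ur: "u r < 0" and vs: "v s > 0" using r(1) by (auto simp: mult_less_0_iff)
  show "v r < 0" by (rule vr)
  have "\<not> v r * u s - u r * v s > 0"
  proof
    assume *: "v r * u s - u r * v s > 0"
    have "\<forall>k\<in>{r..s}. - u r * v k - (- v r) * u k \<ge> 0" using cases * by force
    then show False
      using sw.positive_exit[of "- u r" "- v r" s r s r s] rs vr ur vs le * by auto
  qed
  with \<open>\<not> u r * v s - v r * u s > 0\<close> show "u r * v s = v r * u s" by linarith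
qed

section \<open>Proportionality of the weights\<close>

text \<open>The combination \<open>a * u - b * v\<close> that vanishes at \<open>r\<close> also
  vanishes at \<open>s\<close>. Were it nonzero anywhere, the nearest such cone on one side of
  \<open>{r..s}\<close> would contradict \<open>positive_exit\<close>.\<close>

lemma proportional_aux:
  assumes rs: "r < s" "s < D" and zero: "\<forall>k\<in>{r<..<s}. u k = 0 \<and> v k = 0"
    and r: "u r \<le> 0" "v r \<le> 0" "u r < 0 \<or> v r < 0" and s: "u s > 0"
  shows "\<exists>a b. a > 0 \<and> b > 0 \<and> (\<forall>k<D. a * u k = b * v k)"
proof -
  interpret sw: agreement D N B v u by (rule swap)
  note opp = opposite_directions[OF assms]
  define a b where "a = - v r" and "b = - u r"
  have ab: "a > 0" "b > 0" "a \<le> B" "b \<le> B"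
    using opp u_le[of r] v_le[of r] by (auto simp: a_def b_def)
  define bad where "bad k \<longleftrightarrow> a * u k \<noteq> b * v k" for k
  have base: "\<not> bad k" if "k \<in> {r..s}" for k
  proof -
    have "k = r \<or> k = s \<or> u k = 0 \<and> v k = 0" using zero that by force
    then show ?thesis using opp(4) by (auto simp: bad_def a_def b_def)
  qed
  \<comment> \<open>With a single bad cone \<open>i\<close> the combination has one sign on all of
    \<open>{lo..hi}\<close>; this sign selects the order of \<open>u\<close> and
    \<open>v\<close>.\<close>
  have no_first: False
    if i: "i \<in> {lo..hi}" "r \<in> {lo..hi}" "s \<in> {lo..hi}" "hi < D" "bad i"
      and nb: "\<And>k. k \<in> {lo..hi} \<Longrightarrow> k \<noteq> i \<Longrightarrow> \<not> bad k" for i lo hi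
  proof (cases "a * u i - b * v i > 0")
    case True
    then have "\<forall>k\<in>{lo..hi}. a * u k - b * v k \<ge> 0" using nb by (force simp: bad_def)
    then show False using positive_exit[of a b i lo hi r s] ab i True opp s by auto
  next
    case False
    then have *: "b * v i - a * u i > 0" using i(5) by (auto simp: bad_def)
    then have "\<forall>k\<in>{lo..hi}. b * v k - a * u k \<ge> 0" using nb by (force simp: bad_def)
    then show False using sw.positive_exit[of b a i lo hi r s] ab i * opp s by auto
  qed
  have "\<not> bad k" if "k < D" for k
  proof
    assume k: "bad k"
    show False
    proof (cases "k < r")
      case True
      \<comment> \<open>The bad cone below \<open>r\<close> that is nearest to
        \<open>r\<close>.\<close>
      define i where "i = (GREATEST i. i < r \<and> bad i)"
      have i: "i < r \<and> bad i"
        unfolding i_def by (rule GreatestI_nat[of _ k r]) (use True k in auto)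
      have max: "j \<le> i" if "j < r" "bad j" for j
        unfolding i_def by (rule Greatest_le_nat[of _ j r]) (use that in auto)
      show False
      proof (rule no_first[of i i s])
        show "\<not> bad j" if "j \<in> {i..s}" "j \<noteq> i" for j
          using that max[of j] base[of j] by (cases "j < r") auto
      qed (use i rs in auto)
    next
      case False
      \<comment> \<open>The first bad cone from \<open>r\<close> on; it lies beyond
        \<open>s\<close>, since \<open>{r..s}\<close> contains none.\<close>
      define i where "i = (LEAST i. i \<ge> r \<and> bad i)"
      have i: "i \<ge> r \<and> bad i"
        unfolding i_def by (rule LeastI[of _ k]) (use False k in auto)
      have min: "i \<le> j" if "j \<ge> r" "bad j" for j
        unfolding i_def by (rule Least_le) (use that in auto)
      have "i > s" using base[of i] i by (metis atLeastAtMost_iff not_le)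
      moreover have "i < D" using min[of k] False k that by auto
      ultimately show False
        using no_first[of i r i] i rs min by force
    qed
  qed
  then show ?thesis using ab by (auto simp: bad_def)
qed

text \<open>Take for \<open>s\<close> the first cone where \<open>u\<close> or \<open>v\<close> is
  positive and for \<open>r\<close> the last cone before it where one is negative. Both exist by the
  signs at the ends, and all weights strictly between vanish.\<close>

lemma proportional: "\<exists>a b. a > 0 \<and> b > 0 \<and> (\<forall>k<D. a * u k = b * v k)"
proof -
  interpret sw: agreement D N B v u by (rule swap)
  define s where "s = (LEAST s. u s > 0 \<or> v s > 0)"
  have s: "u s > 0 \<or> v s > 0" unfolding s_def by (rule LeastI[of _ "D - 1"]) (use ends in auto)
  have "s \<le> D - 1" unfolding s_def by (rule Least_le) (use ends in auto)
  then have sD: "s < D" using D by simp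
  have before: "u k \<le> 0 \<and> v k \<le> 0" if "k < s" for k
    using not_less_Least[of k "\<lambda>s. u s > 0 \<or> v s > 0"] that by (auto simp: s_def)
  have s0: "0 < s" using s ends by (cases s) auto
  define r where "r = (GREATEST r. r < s \<and> (u r < 0 \<or> v r < 0))"
  have r: "r < s \<and> (u r < 0 \<or> v r < 0)"
    unfolding r_def by (rule GreatestI_nat[of _ 0 s]) (use s0 ends in auto)
  have r_max: "k \<le> r" if "k < s" "u k < 0 \<or> v k < 0" for k
    unfolding r_def by (rule Greatest_le_nat[of _ k s]) (use that in auto)
  have zero: "u k = 0 \<and> v k = 0" if "k \<in> {r<..<s}" for k
    using r_max[of k] before[of k] that by force
  show ?thesis
  proof (cases "u s > 0")
    case True
    then show ?thesis using proportional_aux[of r s] r sD zero before by auto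
  next
    case False
    then have "\<exists>a b. a > 0 \<and> b > 0 \<and> (\<forall>k<D. a * v k = b * u k)"
      using sw.proportional_aux[of r s] r s sD zero before by blast
    then show ?thesis by metis
  qed
qed

lemma trace_less: "k \<in> set (trace D x) \<Longrightarrow> k < D"
  using D by (auto simp: trace_def intro!: cone_less)

text \<open>Proportional weights with positive factors give proportional scores on words of every
  length.\<close>

lemma agree_everywhere: "score D u x > 0 \<longleftrightarrow> score D v x > 0"
proof -
  obtain a b where ab: "a > 0" "b > 0" "\<forall>k<D. a * u k = b * v k" using proportional by blast
  have "a * score D u x = b * score D v x"
    unfolding score_def using ab(3) trace_less[of _ x]
    by (simp flip: sum_list_const_mult cong: map_cong)
  then show ?thesis using ab(1,2) by (metis zero_less_mult_pos zero_less_mult_iff)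
qed

end

section \<open>Programs as weightings of cones\<close>

text \<open>For \<open>ha h\<close> dividing \<open>D\<close>, the slope of \<open>h\<close> is the
  integer \<open>hb h * (D div ha h)\<close> over \<open>D\<close>, so the head fires from that cone
  upwards. The threshold \<open>z * n\<close> is charged as \<open>z\<close> per position.\<close>

definition weight :: "nat \<Rightarrow> program \<Rightarrow> nat \<Rightarrow> int" where
  "weight D p k = (\<Sum>h\<leftarrow>heads p. hlam h * of_bool (hb h * (int D div ha h) \<le> int k)) - zthr p"

lemma ps_eq_count: "j \<le> length x \<Longrightarrow> ps x j = int (count_list (take j x) True)"
proof (induction j)
  case (Suc j)
  then show ?case by (simp add: ps_def take_Suc_conv_app_nth)
qed (simp add: ps_def)

lemma ps_map: "ps (map f [1..<Suc n]) n = (\<Sum>j<n. of_bool (f (Suc j)))"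
proof -
  have "ps (map f [1..<Suc n]) n = (\<Sum>l = 1..n. of_bool (f l))"
    unfolding ps_def by (intro sum.cong) (auto simp del: upt_Suc)
  also have "\<dots> = (\<Sum>j<n. of_bool (f (Suc j)))"
    by (rule sum.reindex_bij_witness[of _ Suc "\<lambda>l. l - 1"]) auto
  finally show ?thesis .
qed

lemma head_test_iff:
  assumes "ha h > 0" "hb h > 0" "ha h dvd int D" "D \<ge> 1" "x \<noteq> []"
  shows "real_of_int (ps x (length x)) > slope h * real (length x)
    \<longleftrightarrow> hb h * (int D div ha h) \<le> int (cone D x)"
proof -
  obtain e where e: "int D = ha h * e" using assms(3) by (auto elim: dvdE)
  have e0: "e > 0" using e assms(1,4) by (metis of_nat_0_less_iff less_le_trans zero_less_mult_pos zero_less_one)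
  define \<sigma> where "\<sigma> = nat (hb h * e)"
  have \<sigma>: "int \<sigma> = hb h * e" "\<sigma> > 0" using assms(2) e0 by (auto simp: \<sigma>_def)
  let ?c = "count_list x True" and ?n = "length x"
  have "real_of_int (ps x ?n) > slope h * real ?n
      \<longleftrightarrow> real_of_int (hb h) * real ?n < real ?c * real_of_int (ha h)"
    using assms(1) by (simp add: ps_eq_count slope_def field_simps)
  also have "\<dots> \<longleftrightarrow> hb h * int ?n < int ?c * ha h"
    by (metis (mono_tags) of_int_less_iff of_int_mult of_int_of_nat_eq)
  also have "\<dots> \<longleftrightarrow> (hb h * int ?n) * e < (int ?c * ha h) * e"
    using e0 by simp
  also have "\<dots> \<longleftrightarrow> int (\<sigma> * ?n) < int (?c * D)"
    by (simp add: \<sigma> e ac_simps)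
  \<comment> \<open>Positivity of \<open>\<sigma>\<close> matters for words without
    \<open>True\<close>: there both sides are false although the subtraction truncates at 0.\<close>
  also have "\<dots> \<longleftrightarrow> \<sigma> * ?n \<le> ?c * D - 1"
  proof -
    have "0 < \<sigma> * ?n" using \<sigma>(2) assms(5) by simp
    then show ?thesis unfolding of_nat_less_iff by linarith
  qed
  also have "\<dots> \<longleftrightarrow> \<sigma> \<le> cone D x"
    using assms(5) by (simp add: cone_def less_eq_div_iff_mult_less_eq)
  also have "\<dots> \<longleftrightarrow> hb h * (int D div ha h) \<le> int (cone D x)"
    using \<sigma>(1) e assms(1) by (metis nonzero_mult_div_cancel_left less_irrefl of_nat_le_iff)
  finally show ?thesis .
qed

definition admissible :: "nat \<Rightarrow> program \<Rightarrow> bool" where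
  "admissible D p \<longleftrightarrow> D \<ge> 1 \<and> zthr p > 0 \<and> (\<Sum>h\<leftarrow>heads p. hlam h) > zthr p
     \<and> (\<forall>h\<in>set (heads p). 0 < hb h \<and> hb h < ha h \<and> ha h dvd int D)"

lemma sum_list_sum_swap:
  "(\<Sum>h\<leftarrow>hs. \<Sum>j\<in>A. f h j) = (\<Sum>j\<in>A. \<Sum>h\<leftarrow>hs. f h j :: int)"
  by (induction hs) (auto simp: sum.distrib)

text \<open>Exchanging the sums over heads and positions makes each position contribute the weight
  of its cone.\<close>

lemma run_iff_score:
  assumes "admissible D p"
  shows "run p x \<longleftrightarrow> score D (weight D p) x > 0"
proof -
  let ?n = "length x"
  have head: "ps (head_out h x) ?n
      = (\<Sum>j<?n. of_bool (hb h * (int D div ha h) \<le> int (cone D (take (Suc j) x))))"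
    if "h \<in> set (heads p)" for h
  proof -
    have h: "ha h > 0" "hb h > 0" "ha h dvd int D" "D \<ge> 1"
      using assms that by (auto simp: admissible_def)
    have test: "slope h * real (Suc j) < real_of_int (ps x (Suc j))
        \<longleftrightarrow> hb h * (int D div ha h) \<le> int (cone D (take (Suc j) x))" if "j < ?n" for j
    proof -
      have "ps (take (Suc j) x) (Suc j) = ps x (Suc j)" and len: "length (take (Suc j) x) = Suc j"
        using that by (auto simp: ps_eq_count)
      moreover have "take (Suc j) x \<noteq> []" using len by fastforce
      ultimately show ?thesis using head_test_iff[OF h, of "take (Suc j) x"] unfolding len by presburger
    qed
    show ?thesis
      unfolding head_out_def ps_map by (intro sum.cong refl) (simp only: test lessThan_iff)
  qed
  let ?t = "\<lambda>h j. hlam h * of_bool (hb h * (int D div ha h) \<le> int (cone D (take (Suc j) x)))"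
  have "(\<Sum>h\<leftarrow>heads p. hlam h * ps (head_out h x) ?n) = (\<Sum>h\<leftarrow>heads p. \<Sum>j<?n. ?t h j)"
    by (intro arg_cong[of _ _ sum_list] map_cong refl) (simp only: head sum_distrib_left)
  also have "\<dots> = (\<Sum>j<?n. \<Sum>h\<leftarrow>heads p. ?t h j)" by (rule sum_list_sum_swap)
  finally have "(\<Sum>h\<leftarrow>heads p. hlam h * ps (head_out h x) ?n) - zthr p * int ?n
      = (\<Sum>j<?n. weight D p (cone D (take (Suc j) x)))"
    by (simp add: weight_def sum_subtractf)
  also have "\<dots> = score D (weight D p) x"
    by (simp add: score_def trace_def o_def interv_sum_list_conv_sum_set_nat lessThan_atLeast0)
  finally show ?thesis unfolding run_def by linarith
qed

text \<open>All slopes lie strictly between 0 and 1, so no head fires in cone 0 and all heads fire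
  in cone \<open>D - 1\<close>.\<close>

lemma weight_ends:
  assumes "admissible D p"
  shows "weight D p 0 < 0" "weight D p (D - 1) > 0"
proof -
  have *: "0 < hb h * (int D div ha h) \<and> hb h * (int D div ha h) \<le> int (D - 1)"
    if "h \<in> set (heads p)" for h
  proof -
    have h: "0 < hb h" "hb h < ha h" "ha h dvd int D" "D \<ge> 1"
      using assms that by (auto simp: admissible_def)
    obtain e where e: "int D = ha h * e" using h(3) by (auto elim: dvdE)
    have e0: "e > 0" using e h by (metis of_nat_0_less_iff less_le_trans less_trans zero_less_mult_pos zero_less_one)
    have "int D div ha h = e" using e h by simp
    moreover have "hb h * e < ha h * e" using h e0 by simp
    ultimately show ?thesis using e e0 h by auto
  qed
  have "(\<Sum>h\<leftarrow>heads p. hlam h * of_bool (hb h * (int D div ha h) \<le> int 0)) = (\<Sum>h\<leftarrow>heads p. 0)"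
    using * by (intro arg_cong[of _ _ sum_list] map_cong) force+
  then show "weight D p 0 < 0" using assms by (simp add: weight_def admissible_def)
  have "(\<Sum>h\<leftarrow>heads p. hlam h * of_bool (hb h * (int D div ha h) \<le> int (D - 1)))
      = (\<Sum>h\<leftarrow>heads p. hlam h)"
    using * by (intro arg_cong[of _ _ sum_list] map_cong) auto
  then show "weight D p (D - 1) > 0" using assms by (simp add: weight_def admissible_def)
qed

section \<open>Bounds in terms of the complexity\<close>

lemma param_bound_bounds:
  "\<bar>zthr p\<bar> \<le> int (param_bound p)"
  "h \<in> set (heads p) \<Longrightarrow> \<bar>ha h\<bar> \<le> int (param_bound p)"
  "h \<in> set (heads p) \<Longrightarrow> \<bar>hlam h\<bar> \<le> int (param_bound p)"
proof -
  let ?S = "{nat \<bar>zthr p\<bar>} \<union> (\<Union>h\<in>set (heads p). {nat \<bar>ha h\<bar>, nat \<bar>hb h\<bar>, nat \<bar>hlam h\<bar>})"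
  have le: "y \<le> param_bound p" if "y \<in> ?S" for y
    unfolding param_bound_def by (rule Max_ge) (use that in auto)
  show "\<bar>zthr p\<bar> \<le> int (param_bound p)" using le[of "nat \<bar>zthr p\<bar>"] by simp
  show "\<bar>ha h\<bar> \<le> int (param_bound p)" if "h \<in> set (heads p)"
    using le[of "nat \<bar>ha h\<bar>"] that by force
  show "\<bar>hlam h\<bar> \<le> int (param_bound p)" if "h \<in> set (heads p)"
    using le[of "nat \<bar>hlam h\<bar>"] that by force
qed

lemma abs_weight_le:
  "\<bar>weight D p k\<bar> \<le> int (param_bound p) * (1 + int (num_heads p))"
proof -
  let ?f = "\<lambda>h. hlam h * of_bool (hb h * (int D div ha h) \<le> int k)"
  have "\<bar>\<Sum>h\<leftarrow>hs. ?f h\<bar> \<le> int (param_bound p) * int (length hs)" if "set hs \<subseteq> set (heads p)" for hs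
    using that
  proof (induction hs)
    case (Cons h hs)
    then have "\<bar>?f h\<bar> \<le> int (param_bound p)" using param_bound_bounds(3)[of h p] by auto
    with Cons show ?case by (simp add: algebra_simps)
  qed simp
  from this[of "heads p"] show ?thesis
    using param_bound_bounds(1)[of p] by (simp add: weight_def num_heads_def algebra_simps)
qed

text \<open>A product of \<open>K\<close> factors of size at most \<open>T\<close> is at most
  \<open>T ^ K\<close>; this is how the complexity controls the number of cones.\<close>

definition denominator :: "program \<Rightarrow> nat" where
  "denominator p = (\<Prod>h\<leftarrow>heads p. nat (ha h))"

lemma crasp2_heads:
  assumes "p \<in> crasp2"
  shows "zthr p > 0" "(\<Sum>h\<leftarrow>heads p. hlam h) > zthr p" "num_heads p \<ge> 1"
    "h \<in> set (heads p) \<Longrightarrow> 0 < hb h \<and> hb h < ha h"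
  using assms
  by (auto simp: crasp2_def crasp2_KT_def num_heads_def slope_def divide_simps zero_less_divide_iff
      split: if_splits)

lemma denominator_bounds:
  assumes "p \<in> crasp2"
  shows "denominator p \<ge> 1" "denominator p \<le> crasp2_complexity p"
    "h \<in> set (heads p) \<Longrightarrow> ha h dvd int (denominator p)"
proof -
  have ha: "0 < ha h \<and> ha h \<le> int (param_bound p)" if "h \<in> set (heads p)" for h
    using crasp2_heads(4)[OF assms that] param_bound_bounds(2)[OF that] by auto
  have "1 \<le> (\<Prod>h\<leftarrow>hs. nat (ha h)) \<and> (\<Prod>h\<leftarrow>hs. nat (ha h)) \<le> param_bound p ^ length hs"
    if "set hs \<subseteq> set (heads p)" for hs
    using that
  proof (induction hs)
    case (Cons h hs)
    then have "1 \<le> nat (ha h) \<and> nat (ha h) \<le> param_bound p" using ha[of h] by auto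
    with Cons show ?case by (auto intro: mult_mono simp: Suc_le_eq)
  qed simp
  from this[of "heads p"] show "denominator p \<ge> 1" "denominator p \<le> crasp2_complexity p"
    by (auto simp: denominator_def crasp2_complexity_def num_heads_def)
  show "ha h dvd int (denominator p)" if "h \<in> set (heads p)"
  proof -
    have "nat (ha h) dvd denominator p"
      unfolding denominator_def using that by (intro prod_list_dvd) auto
    then show ?thesis using ha[OF that] by (metis int_dvd_int_iff int_nat_eq less_imp_le)
  qed
qed

text \<open>A slope strictly between 0 and 1 has denominator at least 2. There is at least one head,
  hence \<open>T \<ge> 2\<close> and \<open>K < 2 ^ K \<le> T ^ K\<close>.\<close>

lemma complexity_bounds:
  assumes "p \<in> crasp2"
  shows "2 \<le> crasp2_complexity p" "param_bound p \<le> crasp2_complexity p"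
    "num_heads p < crasp2_complexity p"
proof -
  obtain h where h: "h \<in> set (heads p)"
    using crasp2_heads(3)[OF assms] by (cases "heads p") (auto simp: num_heads_def)
  have pb: "param_bound p \<ge> 2"
    using crasp2_heads(4)[OF assms h] param_bound_bounds(2)[OF h] by linarith
  show le: "param_bound p \<le> crasp2_complexity p"
    unfolding crasp2_complexity_def using crasp2_heads(3)[OF assms] pb
    by (intro self_le_power) auto
  then show "2 \<le> crasp2_complexity p" using pb by linarith
  have "num_heads p < 2 ^ num_heads p" by (rule less_exp)
  also have "\<dots> \<le> param_bound p ^ num_heads p" using pb by (intro power_mono) auto
  finally show "num_heads p < crasp2_complexity p" by (simp add: crasp2_complexity_def)
qed

section \<open>Length generalization\<close>

text \<open>Over the common denominator \<open>D \<le> M * M\<close> all weights are bounded by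
  \<open>M * M\<close>, which puts both programs into the setting of
  \<open>agreement\<close>.\<close>

lemma agreement_imp_equal:
  assumes p: "p \<in> crasp2" "crasp2_complexity p \<le> M"
    and q: "q \<in> crasp2" "crasp2_complexity q \<le> M"
    and N: "M ^ 42 \<le> N" and agree: "\<And>x. length x \<le> N \<Longrightarrow> run p x = run q x"
  shows "run p x = run q x"
proof -
  define D where "D = denominator p * denominator q"
  define B where "B = int (M * M)"
  have M: "M \<ge> 2" using complexity_bounds(1)[OF p(1)] p(2) by linarith
  have D1: "D \<ge> 1"
    using denominator_bounds(1)[OF p(1)] denominator_bounds(1)[OF q(1)] by (simp add: D_def)
  have DM: "D \<le> M * M"
    unfolding D_def using denominator_bounds(2)[OF p(1)] denominator_bounds(2)[OF q(1)] p q
    by (intro mult_mono) auto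
  have adm: "admissible D p" "admissible D q"
    using D1 crasp2_heads[OF p(1)] crasp2_heads[OF q(1)] denominator_bounds(3)[OF p(1)]
      denominator_bounds(3)[OF q(1)]
    by (auto simp: admissible_def D_def)
  have weight_le: "\<bar>weight D r k\<bar> \<le> B" if "r \<in> crasp2" "crasp2_complexity r \<le> M" for r k
  proof -
    have "int (param_bound r) * (1 + int (num_heads r)) \<le> int M * int M"
      using complexity_bounds[OF that(1)] that(2) by (intro mult_mono) auto
    then show ?thesis using abs_weight_le[of D r k] by (simp add: B_def)
  qed
  \<comment> \<open>Both factors are at most \<open>M ^ 3\<close>, so their product is at most
    \<open>M ^ 7\<close>, whose sixth power is \<open>M ^ 42\<close>.\<close>
  have size: "((1 + B) * (1 + int D)) ^ 6 \<le> int N"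
  proof -
    have "1 + B \<le> int (M ^ 3)" "1 + int D \<le> int (M ^ 3)"
    proof -
      have "1 + M * M \<le> 2 * (M * M)" using M by (simp add: Suc_le_eq)
      also have "\<dots> \<le> M * (M * M)" using M by (intro mult_right_mono) auto
      finally have "1 + M * M \<le> M ^ 3" by (simp add: power3_eq_cube)
      moreover from this have "1 + D \<le> M ^ 3" using DM by linarith
      ultimately show "1 + B \<le> int (M ^ 3)" "1 + int D \<le> int (M ^ 3)"
        unfolding B_def by linarith+
    qed
    then have "(1 + B) * (1 + int D) \<le> int (M ^ 3) * int (M ^ 3)"
      by (intro mult_mono) (auto simp: B_def)
    also have "\<dots> \<le> int (M ^ 7)"
      unfolding of_nat_mult[symmetric] power_add[symmetric] using M
      by (intro of_nat_mono power_increasing) auto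
    finally have "((1 + B) * (1 + int D)) ^ 6 \<le> int (M ^ 7) ^ 6"
      by (intro power_mono) (auto simp: B_def)
    also have "\<dots> = int (M ^ 42)" by (simp flip: power_mult)
    also have "\<dots> \<le> int N" using N by (rule of_nat_mono)
    finally show ?thesis .
  qed
  interpret agreement D N B "weight D p" "weight D q"
  proof
    show "0 < score D (weight D p) x \<longleftrightarrow> 0 < score D (weight D q) x" if "length x \<le> N" for x
      using agree[OF that] adm by (simp add: run_iff_score)
  qed (use D1 weight_le p q weight_ends adm size in auto)
  show ?thesis using agree_everywhere adm by (simp add: run_iff_score)
qed

theorem theorem5p6:
  "\<exists>C0::real. C0 > 0 \<and>
     (\<forall>A. min_complexity_interpolator crasp2 run crasp2_complexity A \<longrightarrow>
       (\<forall>(T::nat) (K::nat) (f :: bool list \<Rightarrow> bool) (N::nat).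
          T \<ge> 1 \<longrightarrow> K \<ge> 1 \<longrightarrow>
          (\<exists>p\<in>crasp2. num_heads p \<le> K \<and> param_bound p \<le> T \<and> run p = f) \<longrightarrow>
          real N \<ge> C0 * real T powr (C0 * real K) \<longrightarrow>
          (\<forall>x. run (A (training_data N f)) x = f x)))"
\<comment> \<open>The exponent 42 comes from \<open>agreement_imp_equal\<close> with
  \<open>M = T ^ K\<close>; as a factor it only enlarges the bound.\<close>
proof (intro exI[of _ 42] conjI allI impI)
  fix A T K f N x
  assume A: "min_complexity_interpolator crasp2 run crasp2_complexity A"
    and T: "T \<ge> 1" and "K \<ge> (1::nat)"
    and "\<exists>p\<in>crasp2. num_heads p \<le> K \<and> param_bound p \<le> T \<and> run p = f"
    and N: "real N \<ge> 42 * real T powr (42 * real K)"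
  then obtain p where p: "p \<in> crasp2" "num_heads p \<le> K" "param_bound p \<le> T" "run p = f" by blast
  define q where "q = A (training_data N f)"
  have "is_arg_min crasp2_complexity
      (\<lambda>p. p \<in> crasp2 \<and> (\<forall>(x, y)\<in>training_data N f. run p x = y)) q"
    using A p unfolding min_complexity_interpolator_def q_def by blast
  moreover have "\<forall>(x, y)\<in>training_data N f. run p x = y" using p(4) by (auto simp: training_data_def)
  \<comment> \<open>The ground truth \<open>p\<close> itself fits the data, so minimality bounds the
    complexity of \<open>q\<close> by that of \<open>p\<close>.\<close>
  ultimately have q: "q \<in> crasp2" "\<forall>(x, y)\<in>training_data N f. run q x = y"
    "crasp2_complexity q \<le> crasp2_complexity p"
    using p(1) by (auto simp: is_arg_min_def not_less)
  have "crasp2_complexity p \<le> T ^ num_heads p"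
    unfolding crasp2_complexity_def using p(3) by (intro power_mono) auto
  also have "\<dots> \<le> T ^ K" using T p(2) by (intro power_increasing) auto
  finally have p_le: "crasp2_complexity p \<le> T ^ K" .
  have "(T ^ K) ^ 42 \<le> N"
  proof -
    have "real ((T ^ K) ^ 42) = real T powr (42 * real K)"
      using T by (simp add: powr_realpow[symmetric] powr_powr mult.commute)
    also have "\<dots> \<le> 42 * real T powr (42 * real K)" by simp
    also have "\<dots> \<le> real N" by (rule N)
    finally show ?thesis by (simp only: of_nat_le_iff)
  qed
  then have "run q x = run p x"
    using agreement_imp_equal[of q "T ^ K" p N x] p q p_le by (auto simp: training_data_def)
  then show "run (A (training_data N f)) x = f x" using p(4) by (simp add: q_def)
qed simp

end
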